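(* Let $m\ge 4$, $k\ge 1$, and let $3\le q_1<q_2<\dots<q_k\le m+1$ be integers. Then the Lie algebra $\mathfrak{g}_m(q_1,\dots,q_k)$ is a contraction of the Lie algebra $\mathfrak{g}_m$.
   Context: All Lie algebras are over $\mathbb{C}$. Maurer–Cartan (structural) equations $d\omega_l=\sum_{i<j}C_{ij}^l\,\omega_i\wedge\omega_j$ in a basis $\{\omega_i\}$ of the dual space describe the Lie algebra with brackets $[X_i,X_j]=\sum_l C_{ij}^l X_l$ in the dual basis $\{X_i\}$ (the opposite overall sign convention gives an isomorphic algebra). For $m\ge4$, $\mathfrak{g}_m$ is the $(2m+1)$-dimensional Lie algebra with structural equations $d\omega_1=d\omega_2=0$; $d\omega_j=\omega_1\wedge\omega_{j-1}$ for $3\le j\le 2m$; $d\omega_{2m+1}=\sum_{j=2}^{m}(-1)^j\omega_j\wedge\omega_{2m+1-j}$. For integers $3\le q_1<\dots<q_k\le m+1$, $\mathfrak{g}_m(q_1,\dots,q_k)$ is the $(2m+1)$-dimensional Lie algebra with structural equations $d\omega_1=d\omega_2=0$; $d\omega_{q_i}=d\omega_{2m+2-q_i}=0$ for $1\le i\le k$; $d\omega_j=\omega_1\wedge\omega_{j-1}$ for $3\le j\le 2m$ with $j\notin\{q_i,2m+2-q_i\}_{1\le i\le k}$; $d\omega_{2m+1}=\sum_{j=2}^{m}(-1)^j\omega_j\wedge\omega_{2m+1-j}$. Let $\mathfrak{L}^n$ be the variety of complex Lie algebra laws on $\mathbb{C}^n$ (identified with their structure constants in a fixed basis). $GL(n,\mathbb{C})$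 acts on it by $(g*\mu)(x,y)=g(\mu(g^{-1}x,g^{-1}y))$, and $O(\mu)$ denotes the orbit of $\mu$. A law $\lambda$ is a contraction of $\mu$ if $\lambda\in\overline{O(\mu)}$, the closure being taken in the Zariski topology or, equivalently, in the metric topology. *)

theory Defs
  imports "HOL-Analysis.Function_Topology" "Jordan_Normal_Form.Gauss_Jordan_Elimination"
begin

section \<open>Complex Lie algebra laws and contractions\<close>

type_synonym law = "complex vec \<Rightarrow> complex vec \<Rightarrow> complex vec"

definition lie_laws :: "nat \<Rightarrow> law set" where
  "lie_laws n = {\<mu>.
     (\<forall>x\<in>carrier_vec n. \<forall>y\<in>carrier_vec n. \<mu> x y \<in> carrier_vec n) \<and>
     (\<forall>x\<in>carrier_vec n. \<forall>y\<in>carrier_vec n. \<forall>z\<in>carrier_vec n.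
        \<mu> (x + y) z = \<mu> x z + \<mu> y z \<and> \<mu> x (y + z) = \<mu> x y + \<mu> x z) \<and>
     (\<forall>c. \<forall>x\<in>carrier_vec n. \<forall>y\<in>carrier_vec n.
        \<mu> (c \<cdot>\<^sub>v x) y = c \<cdot>\<^sub>v \<mu> x y \<and> \<mu> x (c \<cdot>\<^sub>v y) = c \<cdot>\<^sub>v \<mu> x y) \<and>
     (\<forall>x\<in>carrier_vec n. \<mu> x x = 0\<^sub>v n) \<and>
     (\<forall>x\<in>carrier_vec n. \<forall>y\<in>carrier_vec n. \<forall>z\<in>carrier_vec n.
        \<mu> x (\<mu> y z) + \<mu> y (\<mu> z x) + \<mu> z (\<mu> x y) = 0\<^sub>v n)}"

definition GL :: "nat \<Rightarrow> complex mat set" where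
  "GL n = {g \<in> carrier_mat n n. invertible_mat g}"

definition law_action :: "complex mat \<Rightarrow> law \<Rightarrow> law" where
  "law_action g \<mu> = (\<lambda>x y. g *\<^sub>v \<mu> (the (mat_inverse g) *\<^sub>v x) (the (mat_inverse g) *\<^sub>v y))"

definition law_orbit :: "nat \<Rightarrow> law \<Rightarrow> law set" where
  "law_orbit n \<mu> = (\<lambda>g. law_action g \<mu>) ` GL n"

text \<open>Structure constants in the standard basis. They are extended by zero outside the
  finite index range, so the product topology on the function type induces on them the
  usual metric topology of the space of \<open>n\<^sup>3\<close>-tuples of complex numbers.\<close>

definition struct_consts :: "nat \<Rightarrow> law \<Rightarrow> (nat \<times> nat \<times> nat \<Rightarrow> complex)" where
  "struct_consts n \<mu> = (\<lambda>(i, j, l).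
     if i < n \<and> j < n \<and> l < n then \<mu> (unit_vec n i) (unit_vec n j) $ l else 0)"

definition is_contraction :: "nat \<Rightarrow> law \<Rightarrow> law \<Rightarrow> bool" where
  "is_contraction n \<nu> \<mu> \<longleftrightarrow> \<nu> \<in> lie_laws n \<and> \<mu> \<in> lie_laws n \<and>
     struct_consts n \<nu> \<in> closure (struct_consts n ` law_orbit n \<mu>)"


section \<open>Laws given by Maurer--Cartan equations\<close>

text \<open>A 2-form is represented by its coefficient function: its value at \<open>i\<close>, \<open>j\<close> (with
  \<open>i < j\<close>) is the coefficient of \<open>\<omega>\<^sub>i \<and> \<omega>\<^sub>j\<close>. Indices of the \<open>\<omega>\<^sub>i\<close> start at 1.\<close>

type_synonym two_form = "nat \<Rightarrow> nat \<Rightarrow> complex"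

definition wedge :: "nat \<Rightarrow> nat \<Rightarrow> two_form" where
  "wedge a b = (\<lambda>i j. (if i = a \<and> j = b then 1 else 0) - (if i = b \<and> j = a then 1 else 0))"

text \<open>\<open>d l\<close> is the 2-form \<open>d\<omega>\<^sub>l\<close>. The law is the bilinear alternating map with
  \<open>[X\<^sub>i, X\<^sub>j] = \<Sum>\<^sub>l d l i j X\<^sub>l\<close> for \<open>i < j\<close>, where \<open>X\<^sub>i\<close> is \<open>unit_vec n (i - 1)\<close>, because
  coordinates of vectors are numbered from 0.\<close>

definition law_of_MC :: "nat \<Rightarrow> (nat \<Rightarrow> two_form) \<Rightarrow> law" where
  "law_of_MC n d = (\<lambda>x y. Matrix.vec n (\<lambda>l. \<Sum>i\<in>{1..n}. \<Sum>j\<in>{i<..n}.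
     d (Suc l) i j * (x $ (i - 1) * y $ (j - 1) - x $ (j - 1) * y $ (i - 1))))"

definition MC_g :: "nat \<Rightarrow> nat \<Rightarrow> two_form" where
  "MC_g m l =
    (if 3 \<le> l \<and> l \<le> 2 * m then wedge 1 (l - 1)
     else if l = 2 * m + 1 then (\<lambda>i j. \<Sum>r = 2..m. (-1) ^ r * wedge r (2 * m + 1 - r) i j)
     else (\<lambda>i j. 0))"

definition MC_gq :: "nat \<Rightarrow> nat \<Rightarrow> (nat \<Rightarrow> nat) \<Rightarrow> nat \<Rightarrow> two_form" where
  "MC_gq m k q l =
    (if \<exists>i\<in>{1..k}. l = q i \<or> l = 2 * m + 2 - q i then (\<lambda>i j. 0)
     else if 3 \<le> l \<and> l \<le> 2 * m then wedge 1 (l - 1)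
     else if l = 2 * m + 1 then (\<lambda>i j. \<Sum>r = 2..m. (-1) ^ r * wedge r (2 * m + 1 - r) i j)
     else (\<lambda>i j. 0))"

definition g_law :: "nat \<Rightarrow> law" where
  "g_law m = law_of_MC (2 * m + 1) (MC_g m)"

definition gq_law :: "nat \<Rightarrow> nat \<Rightarrow> (nat \<Rightarrow> nat) \<Rightarrow> law" where
  "gq_law m k q = law_of_MC (2 * m + 1) (MC_gq m k q)"

end

theory Submission
  imports Defs
begin

text \<open>
  Let \<open>c\<^sub>3, \<dots>, c\<^sub>2\<^sub>m\<close> be scalars with \<open>c\<^sub>j = c\<^bsub>2m+2-j\<^esub>\<close> for \<open>3 \<le> j \<le> 2m - 1\<close>. Replacing
  \<open>d\<omega>\<^sub>j = \<omega>\<^sub>1 \<and> \<omega>\<^bsub>j-1\<^esub>\<close> by \<open>d\<omega>\<^sub>j = c\<^sub>j \<omega>\<^sub>1 \<and> \<omega>\<^bsub>j-1\<^esub>\<close> in the equations of the algebra \<open>g\<^sub>m\<close> again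
  gives a Lie algebra, because the symmetry of \<open>c\<close> makes \<open>ad X\<^sub>1\<close> skew for the form \<open>d\<omega>\<^bsub>2m+1\<^esub>\<close>.
  If no \<open>c\<^sub>j\<close> vanishes, this algebra is isomorphic to \<open>g\<^sub>m\<close> by the diagonal map
  \<open>X\<^sub>l \<mapsto> (c\<^sub>3 \<cdots> c\<^sub>l) X\<^sub>l\<close> for \<open>l \<le> 2m\<close>, \<open>X\<^bsub>2m+1\<^esub> \<mapsto> (c\<^sub>3 \<cdots> c\<^bsub>2m-1\<^esub>) X\<^bsub>2m+1\<^esub>\<close>. The algebra
  \<open>g\<^sub>m(q\<^sub>1, \<dots>, q\<^sub>k)\<close> is the case where \<open>c\<close> is \<open>0\<close> on the set of all \<open>q\<^sub>i\<close>, \<open>2m + 2 - q\<^sub>i\<close> and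
  \<open>1\<close> elsewhere; replacing \<open>0\<close> by \<open>t \<rightarrow> 0\<close> exhibits it as a limit.
\<close>

section \<open>The weighted family of laws\<close>

text \<open>The scalars \<open>c\<close> are numbered as the \<open>\<omega>\<^sub>j\<close>, from 1, and the coordinates of vectors from 0.
  Only the values of \<open>c\<close> at \<open>3, \<dots>, 2m\<close> matter.\<close>

definition weighted_law :: "nat \<Rightarrow> (nat \<Rightarrow> complex) \<Rightarrow> law" where
  "weighted_law m c = (\<lambda>x y. Matrix.vec (2 * m + 1) (\<lambda>l.
     if 2 \<le> l \<and> l < 2 * m then c (Suc l) * (x $ 0 * y $ (l - 1) - x $ (l - 1) * y $ 0)
     else if l = 2 * m then \<Sum>r = 2..2 * m - 1. (-1) ^ r * (x $ (r - 1) * y $ (2 * m - r))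
     else 0))"

text \<open>The reflection \<open>j \<mapsto> 2 * m + 2 - j\<close> preserves the range from 3 to
  \<open>2 * m - 1\<close>. It sends \<open>2 * m\<close> to 2, where there is no weight, so
  \<open>c (2 * m)\<close> stays free.\<close>

definition weight_symmetric :: "nat \<Rightarrow> (nat \<Rightarrow> complex) \<Rightarrow> bool" where
  "weight_symmetric m c \<longleftrightarrow> (\<forall>j. 3 \<le> j \<and> j \<le> 2 * m - 1 \<longrightarrow> c (2 * m + 2 - j) = c j)"

lemma weight_symmetricD:
  "weight_symmetric m c \<Longrightarrow> 3 \<le> j \<Longrightarrow> j \<le> 2 * m - 1 \<Longrightarrow> c (2 * m + 2 - j) = c j"
  by (simp add: weight_symmetric_def)

lemma weighted_law_carrier [simp]: "weighted_law m c x y \<in> carrier_vec (2 * m + 1)"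
  by (simp add: weighted_law_def)

lemma dim_weighted_law [simp]: "dim_vec (weighted_law m c x y) = 2 * m + 1"
  by (simp add: weighted_law_def)

lemma weighted_law_index:
  "l < 2 * m + 1 \<Longrightarrow> weighted_law m c x y $ l =
    (if 2 \<le> l \<and> l < 2 * m then c (Suc l) * (x $ 0 * y $ (l - 1) - x $ (l - 1) * y $ 0)
     else if l = 2 * m then \<Sum>r = 2..2 * m - 1. (-1) ^ r * (x $ (r - 1) * y $ (2 * m - r))
     else 0)"
  by (simp add: weighted_law_def)

section \<open>From Maurer-Cartan equations to weighted laws\<close>

lemma sum_over_wedge:
  assumes "1 \<le> a" "a < b" "b \<le> n"
  shows "(\<Sum>i\<in>{1..n}. \<Sum>j\<in>{i<..n}. wedge a b i j * f i j) = f a b"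
proof -
  have "(\<Sum>j\<in>{i<..n}. wedge a b i j * f i j) = (if i = a then f a b else 0)" for i
  proof -
    have "(\<Sum>j\<in>{i<..n}. wedge a b i j * f i j)
        = (\<Sum>j\<in>{i<..n}. if j = b then (if i = a then f a b else 0) else 0)"
      by (rule sum.cong) (use assms in \<open>auto simp: wedge_def\<close>)
    also have "\<dots> = (if i = a then f a b else 0)"
      using assms by (simp add: sum.delta')
    finally show ?thesis .
  qed
  then show ?thesis using assms by simp
qed

lemma sum_over_alternating_pairing:
  fixes f :: "nat \<Rightarrow> nat \<Rightarrow> complex"
  shows "(\<Sum>i\<in>{1..2 * m + 1}. \<Sum>j\<in>{i<..2 * m + 1}.
            (\<Sum>r = 2..m. (-1) ^ r * wedge r (2 * m + 1 - r) i j) * f i j)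
       = (\<Sum>r = 2..m. (-1) ^ r * f r (2 * m + 1 - r))" (is "?L = _")
proof -
  have "?L = (\<Sum>i\<in>{1..2 * m + 1}. \<Sum>r = 2..m. \<Sum>j\<in>{i<..2 * m + 1}.
            (-1) ^ r * (wedge r (2 * m + 1 - r) i j * f i j))"
    by (simp add: sum_distrib_right mult.assoc sum.swap[of _ "{2..m}"])
  also have "\<dots> = (\<Sum>r = 2..m. (-1) ^ r * (\<Sum>i\<in>{1..2 * m + 1}. \<Sum>j\<in>{i<..2 * m + 1}.
            wedge r (2 * m + 1 - r) i j * f i j))"
    by (subst sum.swap) (simp add: sum_distrib_left)
  also have "\<dots> = (\<Sum>r = 2..m. (-1) ^ r * f r (2 * m + 1 - r))"
    by (intro sum.cong refl arg_cong2[where f = times] sum_over_wedge) auto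
  finally show ?thesis .
qed

text \<open>The indices \<open>r\<close> and \<open>2 * m + 1 - r\<close> have opposite parity, so
  reflection turns the subtracted terms into the upper half of a single alternating sum.\<close>

lemma alternating_pairing_unfold:
  fixes a b :: "nat \<Rightarrow> complex"
  assumes "2 \<le> m"
  shows "(\<Sum>r = 2..m. (-1) ^ r * (a r * b (2 * m + 1 - r) - a (2 * m + 1 - r) * b r))
       = (\<Sum>r = 2..2 * m - 1. (-1) ^ r * (a r * b (2 * m + 1 - r)))"
proof -
  let ?h = "\<lambda>r. (-1) ^ r * (a r * b (2 * m + 1 - r))"
  have "(\<Sum>r = m + 1..2 * m - 1. ?h r)
      = (\<Sum>r = 2..m. - ((-1) ^ r * (a (2 * m + 1 - r) * b r)))"
  proof (rule sum.reindex_bij_witness[of _ "\<lambda>r. 2 * m + 1 - r" "\<lambda>r. 2 * m + 1 - r"])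
    fix r assume r: "r \<in> {m + 1..2 * m - 1}"
    have "(-1 :: complex) ^ (2 * m + 1 - r) = - ((-1) ^ r)"
      using r by (cases "even r") auto
    moreover have "2 * m + 1 - (2 * m + 1 - r) = r"
      using r by auto
    ultimately show "- ((-1) ^ (2 * m + 1 - r) * (a (2 * m + 1 - (2 * m + 1 - r)) * b (2 * m + 1 - r)))
        = ?h r"
      by simp
  qed auto
  moreover have "(\<Sum>r = 2..2 * m - 1. ?h r) = (\<Sum>r = 2..m. ?h r) + (\<Sum>r = m + 1..2 * m - 1. ?h r)"
    using assms by (subst sum.union_disjoint[symmetric]) (auto intro!: sum.cong)
  ultimately show ?thesis
    by (simp add: sum.distrib[symmetric] right_diff_distrib)
qed

lemma law_of_MC_weighted:
  assumes "2 \<le> m"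
    and low: "\<And>l. l \<le> 2 \<Longrightarrow> d l = (\<lambda>i j. 0)"
    and mid: "\<And>l i j. 3 \<le> l \<Longrightarrow> l \<le> 2 * m \<Longrightarrow> d l i j = c l * wedge 1 (l - 1) i j"
    and top: "d (2 * m + 1) = (\<lambda>i j. \<Sum>r = 2..m. (-1) ^ r * wedge r (2 * m + 1 - r) i j)"
  shows "law_of_MC (2 * m + 1) d = weighted_law m c"
proof (intro ext eq_vecI)
  fix x y :: "complex vec" and l
  show "dim_vec (law_of_MC (2 * m + 1) d x y) = dim_vec (weighted_law m c x y)"
    by (simp add: law_of_MC_def)
  assume "l < dim_vec (weighted_law m c x y)"
  then have l: "l < 2 * m + 1" by simp
  define f where "f i j = x $ (i - 1) * y $ (j - 1) - x $ (j - 1) * y $ (i - 1)" for i j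
  have L: "law_of_MC (2 * m + 1) d x y $ l
      = (\<Sum>i\<in>{1..2 * m + 1}. \<Sum>j\<in>{i<..2 * m + 1}. d (Suc l) i j * f i j)"
    using l by (simp add: law_of_MC_def f_def)
  consider "l < 2" | "2 \<le> l" "l < 2 * m" | "l = 2 * m" using l by linarith
  then show "law_of_MC (2 * m + 1) d x y $ l = weighted_law m c x y $ l"
  proof cases
    case 1
    then show ?thesis unfolding L using l assms(1) by (simp add: low weighted_law_index)
  next
    case 2
    have "(\<Sum>i\<in>{1..2 * m + 1}. \<Sum>j\<in>{i<..2 * m + 1}. d (Suc l) i j * f i j)
        = c (Suc l) * (\<Sum>i\<in>{1..2 * m + 1}. \<Sum>j\<in>{i<..2 * m + 1}. wedge 1 l i j * f i j)"
      using 2 by (simp add: mid sum_distrib_left mult.assoc)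
    also have "\<dots> = c (Suc l) * f 1 l"
      using 2 by (subst sum_over_wedge) auto
    finally show ?thesis unfolding L using 2 l by (simp add: weighted_law_index f_def)
  next
    case 3
    have "(\<Sum>i\<in>{1..2 * m + 1}. \<Sum>j\<in>{i<..2 * m + 1}. d (Suc l) i j * f i j)
        = (\<Sum>r = 2..m. (-1) ^ r * f r (2 * m + 1 - r))"
      using sum_over_alternating_pairing[of m f] top 3 by simp
    also have "\<dots> = (\<Sum>r = 2..2 * m - 1. (-1) ^ r * (x $ (r - 1) * y $ (2 * m + 1 - r - 1)))"
      unfolding f_def by (rule alternating_pairing_unfold[OF assms(1)])
    finally show ?thesis unfolding L using 3 l by (simp add: weighted_law_index)
  qed
qed

lemma g_law_eq_weighted: "4 \<le> m \<Longrightarrow> g_law m = weighted_law m (\<lambda>_. 1)"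
  unfolding g_law_def by (rule law_of_MC_weighted) (auto simp: MC_g_def)

lemma gq_law_eq_weighted:
  assumes "4 \<le> m" and q: "\<And>i. i \<in> {1..k} \<Longrightarrow> 3 \<le> q i \<and> q i \<le> m + 1"
  shows "gq_law m k q
    = weighted_law m (\<lambda>l. if \<exists>i\<in>{1..k}. l = q i \<or> l = 2 * m + 2 - q i then 0 else 1)"
  unfolding gq_law_def
proof (rule law_of_MC_weighted)
  \<comment> \<open>\<open>MC_gq\<close> tests the exceptional indices first. The top equation
    survives because \<open>q i\<close> is at most \<open>m + 1\<close> and, by
    \<open>3 \<le> q i\<close>, its reflection is at most \<open>2 * m - 1\<close>.\<close>
  have "\<not> (\<exists>i\<in>{1..k}. 2 * m + 1 = q i \<or> 2 * m + 1 = 2 * m + 2 - q i)"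
    using q assms(1) by fastforce
  then show "MC_gq m k q (2 * m + 1) = (\<lambda>i j. \<Sum>r = 2..m. (-1) ^ r * wedge r (2 * m + 1 - r) i j)"
    unfolding MC_gq_def by auto
qed (use assms(1) in \<open>auto simp: MC_gq_def\<close>)

section \<open>Lie algebra axioms for the weighted laws\<close>

lemma weighted_law_alternating:
  assumes "2 \<le> m"
  shows "weighted_law m c x x = 0\<^sub>v (2 * m + 1)"
proof -
  have "(\<Sum>r = 2..2 * m - 1. (-1) ^ r * (x $ (r - 1) * x $ (2 * m - r))) = 0"
    using alternating_pairing_unfold[OF assms, of "\<lambda>r. x $ (r - 1)" "\<lambda>r. x $ (r - 1)"]
    by (simp add: mult.commute)
  then show ?thesis by (intro eq_vecI) (auto simp: weighted_law_index)
qed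

text \<open>The last coordinate is the only one where the Jacobi identity constrains the weights.
  Here it is reduced to a bilinear form \<open>S\<close>, whose symmetry is then all that is
  required.\<close>

lemma weighted_pairing_bracket:
  fixes c :: "nat \<Rightarrow> complex" and S :: "complex vec \<Rightarrow> complex vec \<Rightarrow> complex"
  assumes "2 \<le> m"
  defines "S \<equiv> \<lambda>x z. \<Sum>r = 2..2 * m - 2. (-1) ^ r * c (2 * m + 1 - r) * (x $ (r - 1) * z $ (2 * m - r - 1))"
  shows "weighted_law m c x (weighted_law m c y z) $ (2 * m) = y $ 0 * S x z - z $ 0 * S x y"
proof -
  let ?v = "weighted_law m c y z"
  have "weighted_law m c x ?v $ (2 * m)
      = (\<Sum>r = 2..2 * m - 1. (-1) ^ r * (x $ (r - 1) * ?v $ (2 * m - r)))"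
    by (simp add: weighted_law_index)
  \<comment> \<open>The term \<open>r = 2 * m - 1\<close> reads coordinate 1 of a bracket, which is
    0.\<close>
  also have "{2..2 * m - 1} = insert (2 * m - 1) {2..2 * m - 2}"
    using assms(1) by auto
  also have "(\<Sum>r\<in>insert (2 * m - 1) {2..2 * m - 2}. (-1) ^ r * (x $ (r - 1) * ?v $ (2 * m - r)))
      = (\<Sum>r = 2..2 * m - 2. (-1) ^ r * (x $ (r - 1) * ?v $ (2 * m - r)))"
    using assms(1) by (subst sum.insert) (auto simp: weighted_law_index)
  also have "\<dots> = (\<Sum>r = 2..2 * m - 2.
      y $ 0 * ((-1) ^ r * c (2 * m + 1 - r) * (x $ (r - 1) * z $ (2 * m - r - 1)))
      - z $ 0 * ((-1) ^ r * c (2 * m + 1 - r) * (x $ (r - 1) * y $ (2 * m - r - 1))))"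
  proof (rule sum.cong[OF refl])
    fix r assume r: "r \<in> {2..2 * m - 2}"
    then have "Suc (2 * m - r) = 2 * m + 1 - r" "2 \<le> 2 * m - r" "2 * m - r < 2 * m"
      "2 * m - r < 2 * m + 1"
      by auto
    then show "(-1) ^ r * (x $ (r - 1) * ?v $ (2 * m - r)) =
      y $ 0 * ((-1) ^ r * c (2 * m + 1 - r) * (x $ (r - 1) * z $ (2 * m - r - 1)))
      - z $ 0 * ((-1) ^ r * c (2 * m + 1 - r) * (x $ (r - 1) * y $ (2 * m - r - 1)))"
      by (simp add: weighted_law_index algebra_simps)
  qed
  finally show ?thesis by (simp add: S_def sum_subtractf sum_distrib_left)
qed

text \<open>With \<open>a\<close>, \<open>b\<close> the coordinates of two vectors, this says that \<open>ad X\<^sub>1\<close> is skew for the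
  form \<open>d\<omega>\<^bsub>2m+1\<^esub>\<close>.\<close>

lemma weighted_pairing_symmetric:
  fixes a b :: "nat \<Rightarrow> complex"
  assumes "weight_symmetric m c"
  shows "(\<Sum>r = 2..2 * m - 2. (-1) ^ r * c (2 * m + 1 - r) * (a (r - 1) * b (2 * m - r - 1)))
       = (\<Sum>r = 2..2 * m - 2. (-1) ^ r * c (2 * m + 1 - r) * (b (r - 1) * a (2 * m - r - 1)))"
proof (rule sum.reindex_bij_witness[of _ "\<lambda>r. 2 * m - r" "\<lambda>r. 2 * m - r"])
  fix r assume r: "r \<in> {2..2 * m - 2}"
  have "(-1 :: complex) ^ (2 * m - r) = (-1) ^ r"
    using r by (cases "even r") auto
  moreover have "c (2 * m + 1 - (2 * m - r)) = c (2 * m + 1 - r)"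
    using weight_symmetricD[OF assms, of "r + 1"] r by auto
  moreover have "2 * m - (2 * m - r) - 1 = r - 1"
    using r by auto
  ultimately show "(-1) ^ (2 * m - r) * c (2 * m + 1 - (2 * m - r))
      * (b (2 * m - r - 1) * a (2 * m - (2 * m - r) - 1))
      = (-1) ^ r * c (2 * m + 1 - r) * (a (r - 1) * b (2 * m - r - 1))"
    by (simp only: mult.commute[of "b (2 * m - r - 1)"])
qed auto

lemma weighted_law_jacobi:
  assumes "2 \<le> m" and sym: "weight_symmetric m c"
  shows "weighted_law m c x (weighted_law m c y z) + weighted_law m c y (weighted_law m c z x)
       + weighted_law m c z (weighted_law m c x y) = 0\<^sub>v (2 * m + 1)"
proof (intro eq_vecI)
  fix l assume "l < dim_vec (0\<^sub>v (2 * m + 1) :: complex vec)"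
  then have l: "l < 2 * m + 1" by simp
  have "weighted_law m c x (weighted_law m c y z) $ l + weighted_law m c y (weighted_law m c z x) $ l
       + weighted_law m c z (weighted_law m c x y) $ l = 0"
  proof -
    consider "l < 2" | "2 \<le> l" "l < 2 * m" | "l = 2 * m" using l by linarith
    then show ?thesis
    proof cases
      case 1
      then show ?thesis using assms(1) by (simp add: weighted_law_index)
    next
      case 2
      \<comment> \<open>Coordinate 0 of every bracket vanishes. What remains are products of two
        first coordinates with a third entry, and these cancel in pairs in the cyclic sum.\<close>
      then show ?thesis by (auto simp: weighted_law_index algebra_simps)
    next
      case 3
      define S where "S x z = (\<Sum>r = 2..2 * m - 2. (-1) ^ r * c (2 * m + 1 - r)
        * (x $ (r - 1) * z $ (2 * m - r - 1)))" for x z :: "complex vec"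
      have "S u v = S v u" for u v
        unfolding S_def by (rule weighted_pairing_symmetric[OF sym])
      then show ?thesis
        unfolding 3 weighted_pairing_bracket[OF assms(1)] S_def[symmetric]
        by (metis (no_types, opaque_lifting) add.commute diff_add_cancel diff_add_eq
            diff_self)
    qed
  qed
  then show "(weighted_law m c x (weighted_law m c y z) + weighted_law m c y (weighted_law m c z x)
       + weighted_law m c z (weighted_law m c x y)) $ l = 0\<^sub>v (2 * m + 1) $ l"
    using l by simp
qed simp

lemma weighted_law_in_lie_laws:
  assumes "2 \<le> m" "weight_symmetric m c"
  shows "weighted_law m c \<in> lie_laws (2 * m + 1)"
proof -
  let ?n = "2 * m + 1" and ?\<mu> = "weighted_law m c"
  have add: "?\<mu> (x + y) z = ?\<mu> x z + ?\<mu> y z \<and> ?\<mu> x (y + z) = ?\<mu> x y + ?\<mu> x z"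
    if "x \<in> carrier_vec ?n" "y \<in> carrier_vec ?n" "z \<in> carrier_vec ?n" for x y z
  proof -
    have dims: "dim_vec x = ?n" "dim_vec y = ?n" "dim_vec z = ?n" using that by auto
    show ?thesis
      by (intro conjI eq_vecI)
        (auto simp: weighted_law_index dims algebra_simps sum.distrib[symmetric] intro!: sum.cong)
  qed
  have smult: "?\<mu> (a \<cdot>\<^sub>v x) y = a \<cdot>\<^sub>v ?\<mu> x y \<and> ?\<mu> x (a \<cdot>\<^sub>v y) = a \<cdot>\<^sub>v ?\<mu> x y"
    if "x \<in> carrier_vec ?n" "y \<in> carrier_vec ?n" for a x y
  proof -
    have dims: "dim_vec x = ?n" "dim_vec y = ?n" using that by auto
    show ?thesis
      by (intro conjI eq_vecI)
        (auto simp: weighted_law_index dims algebra_simps sum_distrib_left intro!: sum.cong)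
  qed
  show ?thesis
    unfolding lie_laws_def
    using add smult weighted_law_alternating[OF assms(1)] weighted_law_jacobi[OF assms]
      weighted_law_carrier[of m c]
    by (simp del: weighted_law_carrier)
qed

section \<open>Diagonal base change and the orbit\<close>

lemma diag_mat_mult_vec_index:
  fixes s :: "nat \<Rightarrow> 'a :: comm_semiring_1"
  assumes "x \<in> carrier_vec n" "i < n"
  shows "(Matrix.mat n n (\<lambda>(i, j). if i = j then s i else 0) *\<^sub>v x) $ i = s i * x $ i"
proof -
  have "(Matrix.mat n n (\<lambda>(i, j). if i = j then s i else 0) *\<^sub>v x) $ i
      = (\<Sum>j<n. (if i = j then s i else 0) * x $ j)"
    using assms by (auto simp: scalar_prod_def atLeast0LessThan intro!: sum.cong)
  also have "\<dots> = (\<Sum>j<n. if j = i then s i * x $ i else 0)"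
    by (rule sum.cong) auto
  finally show ?thesis using assms by simp
qed

lemma diag_mat_inverse:
  fixes s :: "nat \<Rightarrow> complex"
  defines "g n \<equiv> Matrix.mat n n (\<lambda>(i, j). if i = j then s i else 0)"
  assumes s: "\<And>i. i < n \<Longrightarrow> s i \<noteq> 0"
  shows diag_mat_in_GL: "g n \<in> GL n"
    and diag_mat_inverse_index: "x \<in> carrier_vec n \<Longrightarrow> i < n \<Longrightarrow>
      (the (mat_inverse (g n)) *\<^sub>v x) $ i = x $ i / s i"
proof -
  let ?h = "Matrix.mat n n (\<lambda>(i, j). if i = j then inverse (s i) else 0)"
  have g: "g n \<in> carrier_mat n n" by (simp add: g_def)
  have gh: "g n * ?h = 1\<^sub>m n" "?h * g n = 1\<^sub>m n"
    using s by (auto simp: g_def scalar_prod_def if_distrib[of "\<lambda>x. x * _"] cong: if_cong)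
  then show "g n \<in> GL n"
    using g by (auto simp: GL_def invertible_mat_def inverts_mat_def)
  \<comment> \<open>\<open>mat_inverse\<close> returns an option; being a unit of the matrix ring
    rules out \<open>None\<close>, so that \<open>the\<close> yields a genuine inverse.\<close>
  have "g n \<in> Units (ring_mat TYPE(complex) n ())"
    unfolding Units_def ring_mat_simps using g gh by (auto intro!: bexI[of _ ?h])
  then have "mat_inverse (g n) \<noteq> None"
    using mat_inverse(1)[OF g, where b = "()"] by blast
  then obtain B where B: "mat_inverse (g n) = Some B" by blast
  note B' = mat_inverse(2)[OF g B]
  assume x: "x \<in> carrier_vec n" and i: "i < n"
  \<comment> \<open>The entries of \<open>B\<close> are never computed: its action is read off by
    solving this diagonal system.\<close>
  have "g n *\<^sub>v (B *\<^sub>v x) = x"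
    using B' g x by (metis assoc_mult_mat_vec one_mult_mat_vec)
  moreover have "(g n *\<^sub>v (B *\<^sub>v x)) $ i = s i * (B *\<^sub>v x) $ i"
    unfolding g_def by (rule diag_mat_mult_vec_index) (use B' x i in auto)
  ultimately show "(the (mat_inverse (g n)) *\<^sub>v x) $ i = x $ i / s i"
    using B s[OF i] by (simp add: field_simps)
qed

text \<open>By symmetry the second factor is the tail of the product after \<open>r\<close>. Hence
  the scaling factors of \<open>X_r\<close> and \<open>X_(2m+1-r)\<close> have the same product for
  every \<open>r\<close>, as a diagonal isomorphism needs for the last bracket.\<close>

lemma prod_weights_reflect:
  assumes sym: "weight_symmetric m c" and r: "2 \<le> r" "r \<le> 2 * m - 1"
  shows "(\<Prod>j = 3..r. c j) * (\<Prod>j = 3..2 * m + 1 - r. c j) = (\<Prod>j = 3..2 * m - 1. c j)"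
proof -
  have "(\<Prod>j = 3..2 * m + 1 - r. c j) = (\<Prod>j = r + 1..2 * m - 1. c j)"
    by (rule prod.reindex_bij_witness[of _ "\<lambda>j. 2 * m + 2 - j" "\<lambda>j. 2 * m + 2 - j"])
      (use r weight_symmetricD[OF sym] in auto)
  moreover have "{3..2 * m - 1} = {3..r} \<union> {r + 1..2 * m - 1}" using r by auto
  ultimately show ?thesis
    by (simp add: prod.union_disjoint ivl_disj_int)
qed

text \<open>Membership is stated for structure constants because the two laws are compared only on
  carrier vectors.\<close>

lemma weighted_law_struct_consts_in_orbit:
  assumes m: "2 \<le> m" and sym: "weight_symmetric m c" and nz: "\<And>j. c j \<noteq> 0"
  shows "struct_consts (2 * m + 1) (weighted_law m c)
    \<in> struct_consts (2 * m + 1) ` law_orbit (2 * m + 1) (weighted_law m (\<lambda>_. 1))"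
proof -
  let ?n = "2 * m + 1"
  \<comment> \<open>\<open>s i\<close> scales \<open>X_(i+1)\<close>, since coordinates start at 0;
    the products for \<open>i = 0\<close> and \<open>i = 1\<close> are empty.\<close>
  define s where "s i = (if i = 2 * m then \<Prod>j = 3..2 * m - 1. c j else \<Prod>j = 3..Suc i. c j)" for i
  define g where "g = Matrix.mat ?n ?n (\<lambda>(i, j). if i = j then s i else 0)"
  have s0: "s i \<noteq> 0" for i using nz by (simp add: s_def)
  have s_first: "s 0 = 1" using m by (simp add: s_def)
  have s_step: "s l = c (Suc l) * s (l - 1)" if "2 \<le> l" "l < 2 * m" for l
  proof -
    have "{3..Suc l} = insert (Suc l) {3..l}" using that by auto
    then show ?thesis using that by (simp add: s_def)
  qed
  have s_pair: "s (2 * m) = s (r - 1) * s (2 * m - r)" if "2 \<le> r" "r \<le> 2 * m - 1" for r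
    using prod_weights_reflect[OF sym that] that m by (auto simp: s_def Suc_diff_le)
  let ?B = "the (mat_inverse g)"
  have idx: "(?B *\<^sub>v x) $ i = x $ i / s i" if "x \<in> carrier_vec ?n" "i < ?n" for x i
    unfolding g_def by (rule diag_mat_inverse_index) (use that s0 in auto)
  have act: "law_action g (weighted_law m (\<lambda>_. 1)) x y $ l = weighted_law m c x y $ l"
    if x: "x \<in> carrier_vec ?n" and y: "y \<in> carrier_vec ?n" and l: "l < ?n" for x y l
  proof -
    have "law_action g (weighted_law m (\<lambda>_. 1)) x y $ l
        = s l * weighted_law m (\<lambda>_. 1) (?B *\<^sub>v x) (?B *\<^sub>v y) $ l"
      unfolding law_action_def g_def by (rule diag_mat_mult_vec_index) (rule weighted_law_carrier, rule l)
    also have "\<dots> = weighted_law m c x y $ l"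
    proof -
      consider "l < 2" | "2 \<le> l" "l < 2 * m" | "l = 2 * m" using l by linarith
      then show ?thesis
      proof cases
        case 1
        then show ?thesis using l m by (simp add: weighted_law_index)
      next
        case 2
        then show ?thesis
          using s0[of "l - 1"] x y
          by (simp add: weighted_law_index idx s_first s_step field_simps)
      next
        case 3
        have "s (2 * m) * ((-1) ^ r * (x $ (r - 1) / s (r - 1) * (y $ (2 * m - r) / s (2 * m - r))))
            = (-1) ^ r * (x $ (r - 1) * y $ (2 * m - r))" if "r \<in> {2..2 * m - 1}" for r
          using s_pair[of r] that s0[of "r - 1"] s0[of "2 * m - r"] by (simp add: field_simps)
        then show ?thesis
          using 3 x y by (auto simp: weighted_law_index idx sum_distrib_left intro!: sum.cong)
      qed
    qed
    finally show ?thesis .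
  qed
  have "struct_consts ?n (weighted_law m c)
      = struct_consts ?n (law_action g (weighted_law m (\<lambda>_. 1)))"
    by (auto simp: struct_consts_def act)
  moreover have "g \<in> GL ?n"
    unfolding g_def by (rule diag_mat_in_GL) (rule s0)
  ultimately show ?thesis unfolding law_orbit_def by blast
qed

section \<open>Degeneration of the weights\<close>

lemma struct_consts_weighted_law_tendsto:
  fixes c :: "'a \<Rightarrow> nat \<Rightarrow> complex"
  assumes "\<And>j. ((\<lambda>t. c t j) \<longlongrightarrow> c0 j) F"
  shows "((\<lambda>t. struct_consts (2 * m + 1) (weighted_law m (c t)))
    \<longlongrightarrow> struct_consts (2 * m + 1) (weighted_law m c0)) F"
proof -
  have "((\<lambda>t. struct_consts (2 * m + 1) (weighted_law m (c t)) p)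
    \<longlongrightarrow> struct_consts (2 * m + 1) (weighted_law m c0) p) F" for p
    by (cases p) (auto simp: struct_consts_def weighted_law_index intro!: tendsto_intros assms)
  then show ?thesis
    \<comment> \<open>The topology on the function type is the product topology, so coordinatewise
      limits suffice.\<close>
    unfolding limitin_canonical_iff[symmetric] euclidean_product_topology[symmetric]
      limitin_componentwise
    by (simp add: euclidean_product_topology)
qed

lemma weighted_law_contraction:
  assumes m: "2 \<le> m" and sym: "weight_symmetric m c"
  shows "is_contraction (2 * m + 1) (weighted_law m c) (weighted_law m (\<lambda>_. 1))"
proof -
  let ?n = "2 * m + 1"
  let ?O = "struct_consts ?n ` law_orbit ?n (weighted_law m (\<lambda>_. 1))"
  define d where "d t j = (if c j = 0 then t else c j)" for t :: complex and j
  have "((\<lambda>t. d t j) \<longlongrightarrow> c j) (at 0)" for j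
    by (cases "c j = 0") (simp_all add: d_def)
  then have lim: "((\<lambda>t. struct_consts ?n (weighted_law m (d t)))
      \<longlongrightarrow> struct_consts ?n (weighted_law m c)) (at 0)"
    by (rule struct_consts_weighted_law_tendsto)
  \<comment> \<open>Reflected weights vanish together and receive the same \<open>t\<close>, so
    \<open>d t\<close> is still symmetric, and for \<open>t \<noteq> 0\<close> it has no
    zeros.\<close>
  have orbit: "struct_consts ?n (weighted_law m (d t)) \<in> ?O" if "t \<noteq> 0" for t
    by (rule weighted_law_struct_consts_in_orbit[OF m])
      (use sym that in \<open>auto simp: d_def weight_symmetric_def\<close>)
  have "\<forall>\<^sub>F t in at 0. struct_consts ?n (weighted_law m (d t)) \<in> closure ?O"
    unfolding eventually_at_filter
    by (rule always_eventually) (intro allI impI subsetD[OF closure_subset] orbit)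
  then have "struct_consts ?n (weighted_law m c) \<in> closure ?O"
    by (rule Lim_in_closed_set[OF closed_closure _ trivial_limit_at lim])
  moreover have "weight_symmetric m (\<lambda>_. 1)" by (simp add: weight_symmetric_def)
  ultimately show ?thesis
    using weighted_law_in_lie_laws[OF m] sym by (simp add: is_contraction_def)
qed

theorem mainTheorem1:
  fixes m k :: nat and q :: "nat \<Rightarrow> nat"
  assumes "m \<ge> 4" and "k \<ge> 1"
    and "strict_mono_on {1..k} q"
    and "\<And>i. i \<in> {1..k} \<Longrightarrow> 3 \<le> q i \<and> q i \<le> m + 1"
  shows "is_contraction (2 * m + 1) (gq_law m k q) (g_law m)"
proof -
  \<comment> \<open>Reflection swaps the two alternatives for the same \<open>i\<close>. The bounds
    on \<open>j\<close> and \<open>q i\<close> keep the natural subtractions from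
    truncating.\<close>
  have "(\<exists>i\<in>{1..k}. 2 * m + 2 - j = q i \<or> 2 * m + 2 - j = 2 * m + 2 - q i)
      \<longleftrightarrow> (\<exists>i\<in>{1..k}. j = q i \<or> j = 2 * m + 2 - q i)" if "j \<le> 2 * m - 1" for j
  proof (rule bex_cong[OF refl])
    fix i assume "i \<in> {1..k}"
    then show "(2 * m + 2 - j = q i \<or> 2 * m + 2 - j = 2 * m + 2 - q i)
        \<longleftrightarrow> (j = q i \<or> j = 2 * m + 2 - q i)"
      using assms(4)[of i] that by linarith
  qed
  then have sym: "weight_symmetric m
      (\<lambda>l. if \<exists>i\<in>{1..k}. l = q i \<or> l = 2 * m + 2 - q i then 0 else 1)"
    unfolding weight_symmetric_def by presburger
  have gq: "gq_law m k q = weighted_law m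
      (\<lambda>l. if \<exists>i\<in>{1..k}. l = q i \<or> l = 2 * m + 2 - q i then 0 else 1)"
    by (rule gq_law_eq_weighted[OF assms(1)]) (rule assms(4))
  have "2 \<le> m" using assms(1) by simp
  then show ?thesis
    unfolding gq g_law_eq_weighted[OF assms(1)] using sym by (rule weighted_law_contraction)
qed

end
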